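(* Consider the FedRK algorithm (described in the context) applied to a linear system $Ax=b$ that is allowed to be underdetermined and has $0$ as a solution, with $\tau=\infty$ local iterations per client, with a finite number $\tau_g=T\in\mathbb{N}$, $T\ge1$, of server iterations per federated round, and with $|S^{(t)}|=N$ for all $t$, where $N\in\mathbb{N}$, $1\le N\le M$, is fixed. Let $X^{(0)}\in\mathbb{R}^n$ be the initial global model and let $X^{(t+1)}$ be the global model after $t+1$ federated rounds. Let $C=\bigcap_{i=1}^M C_i$, where $C_i=\{x\in\mathbb{R}^n:A_ix=b_i\}$, and let $P_C$ be the orthogonal projection onto $C$. Then there exists $0<\beta<1$ such that $$\mathbb{E}\Vert X^{(t+1)}-P_CX^{(0)}\Vert^2\le\beta^{t+1}\Vert X^{(0)}\Vert^2,\qquad t=0,1,2,\dotsc.$$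
   Context: Setting. $A\in\mathbb{R}^{m\times n}$ and $b\in\mathbb{R}^m$ are partitioned by rows into $M$ blocks $A_1,\dots,A_M$ and $b_1,\dots,b_M$; client $i\in[M]=\{1,\dots,M\}$ holds the system $A_ix=b_i$. The vector $0$ is a solution of $Ax=b$ (so $b=0$), but the solution need not be unique. Each $C_i=\{x\in\mathbb{R}^n:A_ix=b_i\}$ is therefore a linear subspace; $P_{C_i}$ denotes the orthogonal projection onto it. $\Vert\cdot\Vert$ is the Euclidean norm. FedRK with $\tau=\infty$. Running infinitely many local randomized Kaczmarz iterations on $A_ix=b_i$ from $X^{(t)}$ yields the limit $P_{C_i}X^{(t)}$. Start from the deterministic initial model $X^{(0)}$. In round $t=0,1,2,\dots$: (1) a subset $S^{(t)}\subseteq[M]$ of clients with $|S^{(t)}|=N$ is sampled uniformly at random among all $N$-element subsets; (2) each client $i\in S^{(t)}$ computes $\Delta_i^{(t)}=P_{C_i}X^{(t)}-X^{(t)}$; (3) with $d_i=\langle\Delta_i^{(t)},\Delta_i^{(t)}+X^{(t)}\rangle$ for $i\in S^{(t)}$, the server performs $\tau_g$ randomized Kaczmarz steps, started at $X^{(t)}$, on the system $\langle\Delta_i^{(t)},x\rangle=d_i$, $i\in S^{(t)}$: rows with $\Delta_i^{(t)}=0$ are ignored, and each step samples an index $i$ uniformly among the remaining ones and replaces the current point $x$ by $x+\frac{d_i-\langle\Delta_i^{(t)},x\rangle}{\Vert\Delta_i^{(t)}\Vert^2}\Delta_i^{(t)}$. The result after $\tau_g$ steps is $X^{(t+1)}$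 (if all $\Delta_i^{(t)}=0$, then $X^{(t+1)}=X^{(t)}$). All random choices are made independently of each other and of the past, given the current state. *)

theory Defs
  imports "HOL-Probability.Probability"
begin

text \<open>
  The rows of \<^term>\<open>A\<close> are indexed by a finite type; a function \<^term>\<open>blk\<close> assigns to each row the
  client that holds it, so that the system of client \<open>i\<close> consists of the rows \<open>r\<close>
  with \<^term>\<open>blk r = i\<close>.
\<close>

definition client_sols ::
    "real^'n^'m \<Rightarrow> real^'m \<Rightarrow> ('m \<Rightarrow> nat) \<Rightarrow> nat \<Rightarrow> (real^'n) set" where
  "client_sols A b blk i = {x. \<forall>r. blk r = i \<longrightarrow> (A *v x) $ r = b $ r}"

text \<open>
  Orthogonal projections are expressed by \<^const>\<open>closest_point\<close>; on a linear subspace this is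
  the orthogonal projection in the sense of the decomposition into a component in the subspace
  and a component perpendicular to it.
\<close>

lemma closest_point_subspace_iff:
  fixes S :: "'a::euclidean_space set"
  assumes S: "subspace S"
  shows "closest_point S x = p \<longleftrightarrow> p \<in> S \<and> (\<forall>v\<in>S. orthogonal (x - p) v)"
proof -
  have cl: "closed S" and cv: "convex S" and ne: "S \<noteq> {}"
    using S closed_subspace subspace_imp_convex subspace_0 by auto
  have perp: "orthogonal (x - closest_point S x) v" if "v \<in> S" for v
  proof -
    let ?q = "closest_point S x"
    have q: "?q \<in> S"
      using cl ne by (rule closest_point_in_set)
    have "(x - ?q) \<bullet> ((?q + v) - ?q) \<le> 0" "(x - ?q) \<bullet> ((?q - v) - ?q) \<le> 0"
      using closest_point_dot[OF cv cl] S q that subspace_add subspace_diff by blast+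
    then show ?thesis
      by (simp add: orthogonal_def)
  qed
  have "p = closest_point S x" if p: "p \<in> S" "\<forall>v\<in>S. orthogonal (x - p) v"
  proof (rule closest_point_unique[OF cv cl p(1)], intro ballI)
    fix z assume "z \<in> S"
    then have "orthogonal (x - p) (p - z)"
      using p S by (simp add: subspace_diff)
    then have "(norm (x - p))\<^sup>2 + (norm (p - z))\<^sup>2 = (norm (x - z))\<^sup>2"
      using norm_add_Pythagorean[of "x - p" "p - z"] by simp
    then have "(norm (x - p))\<^sup>2 \<le> (norm (x - z))\<^sup>2"
      by (metis le_add_same_cancel1 zero_le_power2)
    then show "dist x p \<le> dist x z"
      by (simp add: dist_norm)
  qed
  then show ?thesis
    using perp closest_point_in_set[OF cl ne] by auto
qed

text \<open>
  One randomized Kaczmarz step on the system \<open>\<langle>\<Delta> i, x\<rangle> = d i\<close>, \<open>i \<in> S\<close>. The case distinction is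
  needed because \<^const>\<open>pmf_of_set\<close> is unspecified on the empty set.
\<close>

definition server_step ::
    "nat set \<Rightarrow> (nat \<Rightarrow> real^'n) \<Rightarrow> (nat \<Rightarrow> real) \<Rightarrow> real^'n \<Rightarrow> (real^'n) pmf" where
  "server_step S \<Delta> d x =
     (if \<forall>i\<in>S. \<Delta> i = 0 then return_pmf x
      else map_pmf (\<lambda>i. x + ((d i - \<Delta> i \<bullet> x) / (norm (\<Delta> i))\<^sup>2) *\<^sub>R \<Delta> i)
             (pmf_of_set {i\<in>S. \<Delta> i \<noteq> 0}))"

primrec server_iter ::
    "nat \<Rightarrow> nat set \<Rightarrow> (nat \<Rightarrow> real^'n) \<Rightarrow> (nat \<Rightarrow> real) \<Rightarrow> real^'n \<Rightarrow> (real^'n) pmf" where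
  "server_iter 0 S \<Delta> d x = return_pmf x"
| "server_iter (Suc k) S \<Delta> d x = bind_pmf (server_iter k S \<Delta> d x) (server_step S \<Delta> d)"

text \<open>
  One federated round: the conditional distribution of the new global model, given that the
  current one is \<open>x\<close>. The clients are \<open>1, \<dots>, M\<close> with solution sets \<open>C i\<close>; infinitely many local
  iterations of client \<open>i\<close> return the projection of \<open>x\<close> onto \<open>C i\<close>.
\<close>

definition fedrk_round ::
    "(nat \<Rightarrow> (real^'n) set) \<Rightarrow> nat \<Rightarrow> nat \<Rightarrow> nat \<Rightarrow> real^'n \<Rightarrow> (real^'n) pmf" where
  "fedrk_round C M N T x =
     do {
       S \<leftarrow> pmf_of_set {S. S \<subseteq> {1..M} \<and> card S = N};
       let \<Delta> = (\<lambda>i. closest_point (C i) x - x);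
       let d = (\<lambda>i. \<Delta> i \<bullet> (\<Delta> i + x));
       server_iter T S \<Delta> d x
     }"

text \<open>
  The distribution of the global model after \<open>t\<close> rounds, started at the deterministic point \<open>x0\<close>.
\<close>

primrec fedrk ::
    "(nat \<Rightarrow> (real^'n) set) \<Rightarrow> nat \<Rightarrow> nat \<Rightarrow> nat \<Rightarrow> real^'n \<Rightarrow> nat \<Rightarrow> (real^'n) pmf" where
  "fedrk C M N T x0 0 = return_pmf x0"
| "fedrk C M N T x0 (Suc t) = bind_pmf (fedrk C M N T x0 t) (fedrk_round C M N T)"

text \<open>
  Every random variable is integrable with respect to these distributions, so the Bochner
  integral is a genuine expectation.
\<close>

lemma finite_set_pmf_server_step:
  assumes "finite S"
  shows "finite (set_pmf (server_step S \<Delta> d x))"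
proof (cases "\<forall>i\<in>S. \<Delta> i = 0")
  case False
  then have "{i\<in>S. \<Delta> i \<noteq> 0} \<noteq> {}" "finite {i\<in>S. \<Delta> i \<noteq> 0}"
    using assms by auto
  with False show ?thesis
    by (simp add: server_step_def)
qed (simp add: server_step_def)

lemma finite_set_pmf_fedrk:
  assumes "N \<le> M"
  shows "finite (set_pmf (fedrk C M N T x0 t))"
proof -
  let ?F = "{S. S \<subseteq> {1..M} \<and> card S = N}"
  have iter: "finite (set_pmf (server_iter k S \<Delta> d x))" if "finite S"
    for k S and \<Delta> :: "nat \<Rightarrow> real^'n" and d x
    by (induction k) (auto simp: finite_set_pmf_server_step that)
  have fin: "finite ?F"
    by simp
  have ne: "?F \<noteq> {}"
    using assms obtain_subset_with_card_n[of N "{1..M}"] by auto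
  have round: "finite (set_pmf (fedrk_round C M N T x))" for x
    unfolding fedrk_round_def Let_def set_bind_pmf set_pmf_of_set[OF ne fin]
    using fin by (intro finite_UN_I) (auto intro!: iter finite_subset[of _ "{1..M}"])
  show ?thesis
    by (induction t) (auto simp: round)
qed

lemma integrable_fedrk:
  fixes f :: "real^'n \<Rightarrow> real"
  assumes "N \<le> M"
  shows "integrable (measure_pmf (fedrk C M N T x0 t)) f"
  using assms by (intro integrable_measure_pmf_finite finite_set_pmf_fedrk)

end

theory Submission
  imports Defs
begin

text \<open>
  Let \<open>D\<close> be the common solution space and \<open>\<Delta> i\<close> the update of client \<open>i\<close> at the current model
  \<open>x\<close>. Since \<open>\<Delta> i\<close> is perpendicular to the solution space of client \<open>i\<close>, hence to \<open>D\<close>, every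
  server step projects the model orthogonally onto a hyperplane that contains \<open>D\<close>. This has two
  consequences. The model moves only in directions perpendicular to \<open>D\<close>, so its projection onto
  \<open>D\<close> stays forever that of the initial model (\<open>fedrk_projection\<close>). And by Pythagoras no step
  increases the distance to a point of \<open>D\<close>; the first step of a round, if it uses client \<open>i\<close>,
  lowers the squared distance by exactly the squared norm of \<open>\<Delta> i\<close>
  (\<open>expectation_fedrk_round_decrease\<close>).

  It remains to see that this decrease is proportional to the squared distance from \<open>D\<close>. Finitely
  many subspaces are linearly regular: at every point, the squared distance to at least one of them
  is at least a fixed fraction of the squared distance to their intersection
  (\<open>subspaces_linearly_regular\<close>, by compactness). The client that realizes this depends on the
  current model, but each client with nonzero update has at least a fixed positive probability to be
  selected and then used in the first server step. So a round contracts the expected squared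
  distance to the projection by a factor below one that depends neither on the model nor on the
  number of server steps (\<open>fedrk_round_contraction\<close>), and the theorem follows by iterating.
\<close>

section \<open>Expectations over finite distributions\<close>

lemma expectation_bind_finite:
  fixes h :: "'b \<Rightarrow> real"
  assumes "finite (set_pmf p)" "\<And>x. x \<in> set_pmf p \<Longrightarrow> finite (set_pmf (f x))"
  shows "measure_pmf.expectation (bind_pmf p f) h
       = measure_pmf.expectation p (\<lambda>x. measure_pmf.expectation (f x) h)"
  using assms
  by (subst pmf_expectation_bind[where A = "set_pmf p"])
     (auto simp: integral_measure_pmf_real[OF assms(1)] mult.commute)

lemma expectation_mono_finite:
  fixes f g :: "'a \<Rightarrow> real"
  assumes "finite (set_pmf p)" "\<And>x. x \<in> set_pmf p \<Longrightarrow> f x \<le> g x"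
  shows "measure_pmf.expectation p f \<le> measure_pmf.expectation p g"
  using assms
  by (intro integral_mono_AE integrable_measure_pmf_finite) (auto simp: AE_measure_pmf_iff)

text \<open>
  This turns a decrease for one outcome, together with mere non-increase for the others, into a
  decrease in expectation: the outcome \<open>a\<close> has weight \<^term>\<open>pmf p a\<close>.
\<close>

lemma expectation_le_of_outcome:
  fixes f :: "'a \<Rightarrow> real"
  assumes fin: "finite (set_pmf p)" and le: "\<And>x. x \<in> set_pmf p \<Longrightarrow> f x \<le> V"
    and a: "f a \<le> V - \<delta>"
  shows "measure_pmf.expectation p f \<le> V - pmf p a * \<delta>"
proof -
  have "measure_pmf.expectation p f
      \<le> measure_pmf.expectation p (\<lambda>x. V - \<delta> * indicator {a} x)"
    using le a by (intro expectation_mono_finite[OF fin]) (auto simp: indicator_def)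
  also have "\<dots> = V - pmf p a * \<delta>"
    by (subst Bochner_Integration.integral_diff)
       (auto intro!: integrable_measure_pmf_finite[OF fin] simp: measure_pmf_single mult.commute)
  finally show ?thesis .
qed

section \<open>Server iterations\<close>

lemma kaczmarz_step_Pythagoras:
  fixes u x p :: "'a::real_inner"
  assumes "u \<bullet> p = d"
  shows "(norm (x + ((d - u \<bullet> x) / (norm u)\<^sup>2) *\<^sub>R u - p))\<^sup>2
       = (norm (x - p))\<^sup>2 - (d - u \<bullet> x)\<^sup>2 / (norm u)\<^sup>2"
proof (cases "u = 0")
  case False
  define c where "c = (d - u \<bullet> x) / (norm u)\<^sup>2"
  have c: "c * (norm u)\<^sup>2 = d - u \<bullet> x"
    using False by (simp add: c_def)
  have "(norm (x + c *\<^sub>R u - p))\<^sup>2 = (norm ((x - p) + c *\<^sub>R u))\<^sup>2"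
    by (simp add: algebra_simps)
  also have "\<dots> = (norm (x - p))\<^sup>2 + 2 * c * (u \<bullet> x - d) + c * (c * (norm u)\<^sup>2)"
    unfolding power2_norm_eq_inner assms[symmetric]
    by (simp add: inner_simps inner_commute algebra_simps)
  also have "\<dots> = (norm (x - p))\<^sup>2 - c * (d - u \<bullet> x)"
    unfolding c by (simp add: algebra_simps)
  finally show ?thesis
    by (simp add: c_def power2_eq_square)
qed simp

lemma server_step_cases:
  assumes "finite S" "y \<in> set_pmf (server_step S \<Delta> d x)"
  obtains "y = x"
  | i where "i \<in> S" "y = x + ((d i - \<Delta> i \<bullet> x) / (norm (\<Delta> i))\<^sup>2) *\<^sub>R \<Delta> i"
proof (cases "\<forall>i\<in>S. \<Delta> i = 0")
  case True
  with assms that show thesis by (simp add: server_step_def)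
next
  case False
  then have "{i\<in>S. \<Delta> i \<noteq> 0} \<noteq> {}" "finite {i\<in>S. \<Delta> i \<noteq> 0}"
    using assms by auto
  note support = set_pmf_of_set[OF this]
  from assms(2) False obtain i where "i \<in> {i\<in>S. \<Delta> i \<noteq> 0}"
    "y = x + ((d i - \<Delta> i \<bullet> x) / (norm (\<Delta> i))\<^sup>2) *\<^sub>R \<Delta> i"
    unfolding server_step_def if_not_P[OF False] set_map_pmf support by blast
  with that show thesis by blast
qed

lemma finite_set_pmf_server_iter:
  "finite S \<Longrightarrow> finite (set_pmf (server_iter k S \<Delta> d x))"
  by (induction k) (auto simp: finite_set_pmf_server_step)

text \<open>
  The server moves only within the span of the \<open>\<Delta> i\<close>; this is what keeps the projection of the
  model onto the common solution space unchanged.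
\<close>

lemma server_iter_orthogonal:
  assumes "finite S" "\<And>i. i \<in> S \<Longrightarrow> \<Delta> i \<bullet> v = 0"
    "y \<in> set_pmf (server_iter k S \<Delta> d x)"
  shows "y \<bullet> v = x \<bullet> v"
  using assms(3)
proof (induction k arbitrary: y)
  case (Suc k)
  then obtain z where z: "z \<in> set_pmf (server_iter k S \<Delta> d x)"
    "y \<in> set_pmf (server_step S \<Delta> d z)" by auto
  have "y \<bullet> v = z \<bullet> v"
    using assms(1) z(2) by (rule server_step_cases) (auto simp: inner_simps assms(2))
  with Suc.IH[OF z(1)] show ?case by simp
qed simp

lemma server_step_norm_le:
  assumes "finite S" "\<And>i. i \<in> S \<Longrightarrow> \<Delta> i \<bullet> p = d i"
    "y \<in> set_pmf (server_step S \<Delta> d x)"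
  shows "(norm (y - p))\<^sup>2 \<le> (norm (x - p))\<^sup>2"
  using assms(1,3)
  by (rule server_step_cases) (auto simp: kaczmarz_step_Pythagoras[OF assms(2)])

lemma expectation_server_step_le:
  assumes fin: "finite S" and p: "\<And>i. i \<in> S \<Longrightarrow> \<Delta> i \<bullet> p = d i"
  shows "measure_pmf.expectation (server_step S \<Delta> d x) (\<lambda>y. (norm (y - p))\<^sup>2)
       \<le> (norm (x - p))\<^sup>2"
  using expectation_mono_finite[OF finite_set_pmf_server_step[OF fin],
      of \<Delta> d x "\<lambda>y. (norm (y - p))\<^sup>2" "\<lambda>_. (norm (x - p))\<^sup>2"]
    server_step_norm_le[OF fin p]
  by simp

text \<open>
  Row \<open>j\<close> is used with probability at least \<^term>\<open>1 / card S\<close>, as only nonzero rows are sampled.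
  If row \<open>j\<close> is itself zero, then the claimed decrease is zero because of division by zero.
\<close>

lemma expectation_server_step_decrease:
  assumes fin: "finite S" and p: "\<And>i. i \<in> S \<Longrightarrow> \<Delta> i \<bullet> p = d i" and j: "j \<in> S"
  shows "measure_pmf.expectation (server_step S \<Delta> d x) (\<lambda>y. (norm (y - p))\<^sup>2)
       \<le> (norm (x - p))\<^sup>2 - (d j - \<Delta> j \<bullet> x)\<^sup>2 / (norm (\<Delta> j))\<^sup>2 / card S"
proof (cases "\<Delta> j = 0")
  case True
  then show ?thesis
    using expectation_server_step_le[OF fin p] by simp
next
  case False
  let ?R = "{i\<in>S. \<Delta> i \<noteq> 0}"
  let ?\<delta> = "(d j - \<Delta> j \<bullet> x)\<^sup>2 / (norm (\<Delta> j))\<^sup>2"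
  let ?y = "\<lambda>i. x + ((d i - \<Delta> i \<bullet> x) / (norm (\<Delta> i))\<^sup>2) *\<^sub>R \<Delta> i"
  have R: "?R \<noteq> {}" "finite ?R" "j \<in> ?R"
    using False j fin by auto
  have "measure_pmf.expectation (server_step S \<Delta> d x) (\<lambda>y. (norm (y - p))\<^sup>2)
      = measure_pmf.expectation (pmf_of_set ?R) (\<lambda>i. (norm (?y i - p))\<^sup>2)"
    using False j by (auto simp: server_step_def)
  also have "\<dots> \<le> (norm (x - p))\<^sup>2 - pmf (pmf_of_set ?R) j * ?\<delta>"
    using R j by (intro expectation_le_of_outcome) (auto simp: kaczmarz_step_Pythagoras p)
  also have "\<dots> = (norm (x - p))\<^sup>2 - ?\<delta> / card ?R"
    by (subst pmf_of_set[OF R(1,2)]) (use R in simp)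
  also have "\<dots> \<le> (norm (x - p))\<^sup>2 - ?\<delta> / card S"
  proof -
    have "0 < card ?R" "card ?R \<le> card S"
      using R fin card_gt_0_iff by (blast, intro card_mono) auto
    then show ?thesis by (intro diff_left_mono divide_left_mono) auto
  qed
  finally show ?thesis .
qed

text \<open>
  Later steps can only help, so the gain of the first one is a valid bound for the whole round.
\<close>

lemma expectation_server_iter_le_step:
  assumes fin: "finite S" and p: "\<And>i. i \<in> S \<Longrightarrow> \<Delta> i \<bullet> p = d i"
  shows "measure_pmf.expectation (server_iter (Suc k) S \<Delta> d x) (\<lambda>y. (norm (y - p))\<^sup>2)
       \<le> measure_pmf.expectation (server_step S \<Delta> d x) (\<lambda>y. (norm (y - p))\<^sup>2)"
proof (induction k)
  case 0
  show ?case by (simp add: bind_return_pmf)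
next
  case (Suc k)
  have "measure_pmf.expectation (server_iter (Suc (Suc k)) S \<Delta> d x) (\<lambda>y. (norm (y - p))\<^sup>2)
      \<le> measure_pmf.expectation (server_iter (Suc k) S \<Delta> d x) (\<lambda>y. (norm (y - p))\<^sup>2)"
    unfolding server_iter.simps(2)[of "Suc k"]
    by (subst expectation_bind_finite; (intro expectation_mono_finite)?)
       (auto intro: finite_set_pmf_server_iter finite_set_pmf_server_step fin
          expectation_server_step_le p simp del: server_iter.simps)
  with Suc show ?case by linarith
qed

section \<open>Linear regularity of finitely many subspaces\<close>

lemma closest_point_subspace:
  fixes S :: "'a::euclidean_space set"
  assumes "subspace S"
  shows closest_point_subspace_in: "closest_point S x \<in> S"
    and closest_point_subspace_orthogonal: "v \<in> S \<Longrightarrow> (closest_point S x - x) \<bullet> v = 0"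
  using closest_point_subspace_iff[OF assms, of x "closest_point S x"]
  by (auto simp: orthogonal_def inner_diff_left)

lemma closest_point_subspace_eqI:
  fixes S :: "'a::euclidean_space set"
  assumes "subspace S" "p \<in> S" "\<And>v. v \<in> S \<Longrightarrow> (x - p) \<bullet> v = 0"
  shows "closest_point S x = p"
  using assms by (simp add: closest_point_subspace_iff orthogonal_def)

lemma closest_point_subspace_scaleR:
  fixes S :: "'a::euclidean_space set"
  assumes S: "subspace S"
  shows "closest_point S (c *\<^sub>R x) = c *\<^sub>R closest_point S x"
proof (rule closest_point_subspace_eqI[OF S])
  show "c *\<^sub>R closest_point S x \<in> S"
    by (intro subspace_scale S closest_point_subspace_in)
  show "(c *\<^sub>R x - c *\<^sub>R closest_point S x) \<bullet> v = 0" if "v \<in> S" for v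
    using closest_point_subspace_orthogonal[OF S that, of x]
    by (simp add: inner_simps)
qed

lemma closest_point_subspace_diff:
  fixes S :: "'a::euclidean_space set"
  assumes S: "subspace S" and q: "q \<in> S"
  shows "closest_point S (x - q) = closest_point S x - q"
proof (rule closest_point_subspace_eqI[OF S])
  show "closest_point S x - q \<in> S"
    by (intro subspace_diff S closest_point_subspace_in q)
  show "(x - q - (closest_point S x - q)) \<bullet> v = 0" if "v \<in> S" for v
    using closest_point_subspace_orthogonal[OF S that, of x]
    by (simp add: inner_simps)
qed

text \<open>
  On the unit sphere of the orthogonal complement of the intersection, the sum of the squared
  distances to the subspaces is continuous and has no zero, since a zero would lie in all the
  subspaces and be orthogonal to itself. By compactness the sum is bounded below there, and some
  summand is at least the average. Translation along the intersection and scaling reduce every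
  point to that sphere.
\<close>

lemma subspaces_linearly_regular:
  fixes C :: "'b \<Rightarrow> 'a::euclidean_space set"
  assumes I: "finite I" "I \<noteq> {}" and sub: "\<And>i. i \<in> I \<Longrightarrow> subspace (C i)"
  obtains c where "0 < c"
    "\<And>x. \<exists>i\<in>I. c * (norm (x - closest_point (\<Inter>i\<in>I. C i) x))\<^sup>2
                 \<le> (norm (closest_point (C i) x - x))\<^sup>2"
proof -
  let ?D = "\<Inter>i\<in>I. C i"
  define g where "g x = (\<Sum>i\<in>I. (norm (closest_point (C i) x - x))\<^sup>2)" for x
  have D: "subspace ?D" using sub by (auto intro: subspace_Inter)
  have cont: "continuous_on UNIV (closest_point (C i))" if "i \<in> I" for i
    using sub[OF that] subspace_0[OF sub[OF that]]
    by (intro continuous_on_closest_point subspace_imp_convex closed_subspace) auto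
  have contg: "continuous_on A g" for A
    unfolding g_def using cont
    by (intro continuous_intros) (auto intro: continuous_on_subset)
  let ?K = "sphere 0 1 \<inter> ?D\<^sup>\<bottom>"
  have cK: "compact ?K"
    by (intro compact_Int_closed closed_subspace subspace_orthogonal_comp) auto
  have pos: "g x > 0" if "x \<in> ?K" for x
  proof (rule ccontr)
    assume "\<not> g x > 0"
    moreover have "g x \<ge> 0" unfolding g_def by (intro sum_nonneg) auto
    ultimately have "\<forall>i\<in>I. closest_point (C i) x = x"
      using I by (simp add: g_def sum_nonneg_eq_0_iff)
    then have "x \<in> ?D" using closest_point_subspace_in[OF sub] by (metis INT_I)
    with that have "x \<bullet> x = 0" by (auto simp: orthogonal_comp_def orthogonal_def)
    with that show False by simp
  qed
  obtain e where e: "e > 0" "\<And>x. x \<in> ?K \<Longrightarrow> e \<le> g x"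
  proof (cases "?K = {}")
    case True
    then show ?thesis using that[of 1] by auto
  next
    case False
    from continuous_attains_inf[OF cK False contg] pos that show ?thesis by blast
  qed
  have reg: "e * (norm (x - closest_point ?D x))\<^sup>2 \<le> g x" for x
  proof (cases "x = closest_point ?D x")
    case True
    then show ?thesis by (simp add: g_def sum_nonneg)
  next
    case False
    define q where "q = closest_point ?D x"
    define r where "r = norm (x - q)"
    have r: "r > 0" using False by (simp add: r_def q_def)
    have q: "q \<in> ?D" unfolding q_def by (rule closest_point_subspace_in[OF D])
    let ?u = "(1 / r) *\<^sub>R (x - q)"
    have "(x - q) \<bullet> v = 0" if "v \<in> ?D" for v
      using closest_point_subspace_orthogonal[OF D that, of x] by (simp add: q_def inner_simps)
    then have "?u \<in> ?D\<^sup>\<bottom>"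
      unfolding orthogonal_comp_def orthogonal_def
      by (auto simp: inner_commute[of _ "x - q"] simp del: INT_iff)
    moreover have "norm ?u = 1" using r unfolding norm_scaleR r_def[symmetric] by simp
    ultimately have "e \<le> g ?u" by (intro e(2) IntI) (simp_all only: mem_sphere dist_0_norm)
    also have "g ?u = g x / r\<^sup>2"
    proof -
      have "norm (closest_point (C i) ?u - ?u) = norm (closest_point (C i) x - x) / r"
        if "i \<in> I" for i
      proof -
        have "closest_point (C i) ?u - ?u = (1 / r) *\<^sub>R (closest_point (C i) x - x)"
        proof -
          have "q \<in> C i" using that q by blast
          then have "closest_point (C i) ?u = (1 / r) *\<^sub>R (closest_point (C i) x - q)"
            by (simp only: closest_point_subspace_scaleR closest_point_subspace_diff sub[OF that])
          then show ?thesis by (simp add: algebra_simps)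
        qed
        then show ?thesis using r by simp
      qed
      then show ?thesis by (simp add: g_def power_divide sum_divide_distrib)
    qed
    finally show ?thesis using r by (simp add: field_simps r_def q_def)
  qed
  show thesis
  proof (rule that)
    show c: "0 < e / card I" using e I by (simp add: card_gt_0_iff)
    show "\<exists>i\<in>I. e / card I * (norm (x - closest_point ?D x))\<^sup>2
          \<le> (norm (closest_point (C i) x - x))\<^sup>2" for x
    proof (rule ccontr)
      assume "\<not> ?thesis"
      then have "g x < (\<Sum>i\<in>I. e / card I * (norm (x - closest_point ?D x))\<^sup>2)"
        unfolding g_def using I by (intro sum_strict_mono) (auto simp: not_le)
      also have "\<dots> = e * (norm (x - closest_point ?D x))\<^sup>2" using I by simp
      finally show False using reg[of x] by simp
    qed
  qed
qed

section \<open>Federated rounds\<close>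

context
  fixes C :: "nat \<Rightarrow> (real^'n) set" and M N :: nat
  assumes subspace_C: "\<And>i. i \<in> {1..M} \<Longrightarrow> subspace (C i)"
    and N: "1 \<le> N" "N \<le> M"
begin

abbreviation common :: "(real^'n) set" where
  "common \<equiv> \<Inter>i\<in>{1..M}. C i"

abbreviation selections :: "nat set set" where
  "selections \<equiv> {S. S \<subseteq> {1..M} \<and> card S = N}"

abbreviation update :: "real^'n \<Rightarrow> nat \<Rightarrow> real^'n" where
  "update x i \<equiv> closest_point (C i) x - x"

lemma subspace_common: "subspace common"
  using subspace_C by (auto intro: subspace_Inter)

lemma selections_nonempty: "selections \<noteq> {}"
  using N obtain_subset_with_card_n[of N "{1..M}"] by auto

lemma finite_selections: "finite selections"
  by simp

lemma set_pmf_fedrk_round: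
  "set_pmf (fedrk_round C M N T x)
     = (\<Union>S\<in>selections. set_pmf (server_iter T S (update x)
          (\<lambda>i. update x i \<bullet> (update x i + x)) x))"
  by (simp only: fedrk_round_def Let_def set_bind_pmf
      set_pmf_of_set[OF selections_nonempty finite_selections])

lemma finite_set_pmf_fedrk_round: "finite (set_pmf (fedrk_round C M N T x))"
  using finite_set_pmf_fedrk[OF N(2), of C T x "Suc 0"] by (simp add: bind_return_pmf)

lemma update_orthogonal_common:
  assumes "i \<in> {1..M}" "v \<in> common"
  shows "update x i \<bullet> v = 0"
  using assms by (intro closest_point_subspace_orthogonal subspace_C) auto

lemma fedrk_round_projection:
  assumes "y \<in> set_pmf (fedrk_round C M N T x)"
  shows "closest_point common y = closest_point common x"
proof (rule closest_point_subspace_eqI[OF subspace_common])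
  show "closest_point common x \<in> common"
    by (rule closest_point_subspace_in[OF subspace_common])
  fix v assume v: "v \<in> common"
  obtain S where S: "S \<subseteq> {1..M}"
    "y \<in> set_pmf (server_iter T S (update x) (\<lambda>i. update x i \<bullet> (update x i + x)) x)"
    using assms unfolding set_pmf_fedrk_round by auto
  have "y \<bullet> v = x \<bullet> v"
    using S v by (intro server_iter_orthogonal[OF _ _ S(2)] update_orthogonal_common)
      (auto intro: finite_subset)
  with closest_point_subspace_orthogonal[OF subspace_common v, of x]
  show "(y - closest_point common x) \<bullet> v = 0"
    by (simp add: inner_diff_left)
qed

text \<open>
  If client \<open>j\<close> is selected and its equation is the first one used, the model jumps to its
  projection onto \<open>C j\<close>, and by Pythagoras the squared distance to a common solution \<open>p\<close> drops by
  the squared length of the jump. This has probability at least \<^term>\<open>1 / (card selections * N)\<close>.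
  All other choices and later steps project onto hyperplanes through \<open>p\<close> and do not increase the
  distance.
\<close>

lemma expectation_fedrk_round_decrease:
  assumes T: "1 \<le> T" and j: "j \<in> {1..M}" and p: "p \<in> common"
  shows "measure_pmf.expectation (fedrk_round C M N T x) (\<lambda>y. (norm (y - p))\<^sup>2)
       \<le> (norm (x - p))\<^sup>2 - (norm (update x j))\<^sup>2 / (card selections * N)"
proof -
  define d where "d i = update x i \<bullet> (update x i + x)" for i
  obtain k where k: "T = Suc k" using T by (cases T) auto
  let ?E = "\<lambda>S. measure_pmf.expectation (server_iter T S (update x) d x) (\<lambda>y. (norm (y - p))\<^sup>2)"
  have round: "fedrk_round C M N T x
      = bind_pmf (pmf_of_set selections) (\<lambda>S. server_iter T S (update x) d x)"
    by (simp only: fedrk_round_def Let_def d_def[abs_def])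
  note support = set_pmf_of_set[OF selections_nonempty finite_selections]
  have fin: "finite S" if "S \<in> selections" for S
    using that by (auto intro: finite_subset)
  \<comment> \<open>Both sides vanish: the update is perpendicular to \<open>C i\<close>, which contains \<open>p\<close> and the
    projection of \<open>x\<close>.\<close>
  have cons: "update x i \<bullet> p = d i" if "i \<in> S" "S \<in> selections" for i S
  proof -
    have i: "i \<in> {1..M}" using that by auto
    have "d i = 0"
      unfolding d_def
      using closest_point_subspace_orthogonal[OF subspace_C[OF i]
          closest_point_subspace_in[OF subspace_C[OF i]], of x x] by simp
    with update_orthogonal_common[OF i p] show ?thesis by simp
  qed
  have step: "?E S \<le> measure_pmf.expectation (server_step S (update x) d x)
      (\<lambda>y. (norm (y - p))\<^sup>2)" if "S \<in> selections" for S
    unfolding k using that by (intro expectation_server_iter_le_step fin cons) auto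
  have le: "?E S \<le> (norm (x - p))\<^sup>2" if "S \<in> selections" for S
    by (rule order_trans[OF step[OF that]
          expectation_server_step_le[OF fin[OF that] cons[OF _ that]]])
  obtain S0 where S0: "S0 \<in> selections" "j \<in> S0"
  proof -
    have "N - 1 \<le> card ({1..M} - {j})" using N j by simp
    then obtain S where S: "S \<subseteq> {1..M} - {j}" "card S = N - 1"
      by (rule obtain_subset_with_card_n)
    then have "finite S" "j \<notin> S" by (auto intro: finite_subset)
    with S N j have "insert j S \<in> selections" by auto
    then show ?thesis using that by blast
  qed
  have residual: "d j - update x j \<bullet> x = (norm (update x j))\<^sup>2"
    unfolding d_def inner_add_right[of "update x j" "update x j" x] power2_norm_eq_inner
    by linarith
  have gain: "(d j - update x j \<bullet> x)\<^sup>2 / (norm (update x j))\<^sup>2 = (norm (update x j))\<^sup>2"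
    unfolding residual power2_eq_square by simp
  have "measure_pmf.expectation (server_step S0 (update x) d x) (\<lambda>y. (norm (y - p))\<^sup>2)
      \<le> (norm (x - p))\<^sup>2 - (d j - update x j \<bullet> x)\<^sup>2 / (norm (update x j))\<^sup>2 / card S0"
    by (rule expectation_server_step_decrease[OF fin[OF S0(1)] cons[OF _ S0(1)] S0(2)])
  then have "?E S0 \<le> (norm (x - p))\<^sup>2 - (norm (update x j))\<^sup>2 / N"
    using step[OF S0(1)] S0(1) unfolding gain by simp
  then have "measure_pmf.expectation (pmf_of_set selections) ?E
      \<le> (norm (x - p))\<^sup>2 - pmf (pmf_of_set selections) S0 * ((norm (update x j))\<^sup>2 / N)"
    by (intro expectation_le_of_outcome le) (simp_all only: support finite_selections)
  moreover have "pmf (pmf_of_set selections) S0 = 1 / card selections"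
    using S0 by (subst pmf_of_set[OF selections_nonempty finite_selections]) auto
  moreover have "measure_pmf.expectation (fedrk_round C M N T x) (\<lambda>y. (norm (y - p))\<^sup>2)
      = measure_pmf.expectation (pmf_of_set selections) ?E"
    unfolding round
    by (rule expectation_bind_finite)
       (simp_all only: support finite_selections finite_set_pmf_server_iter[OF fin])
  ultimately show ?thesis by simp
qed

lemma fedrk_round_contraction:
  assumes T: "1 \<le> T"
  obtains \<beta> where "0 < \<beta>" "\<beta> < 1"
    "\<And>x. measure_pmf.expectation (fedrk_round C M N T x)
            (\<lambda>y. (norm (y - closest_point common x))\<^sup>2)
          \<le> \<beta> * (norm (x - closest_point common x))\<^sup>2"
proof -
  obtain c where c: "0 < c"
    "\<And>x. \<exists>i\<in>{1..M}. c * (norm (x - closest_point common x))\<^sup>2 \<le> (norm (update x i))\<^sup>2"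
    using subspaces_linearly_regular[of "{1..M}" C] subspace_C N by auto
  have K: "0 < real (card selections * N)"
    using selections_nonempty finite_selections N by (simp add: card_gt_0_iff)
  define a where "a = c / (card selections * N)"
  have a: "0 < a" using c K by (simp add: a_def)
  show thesis
  proof (rule that)
    \<comment> \<open>The maximum only keeps the factor positive.\<close>
    show "0 < max (1 / 2) (1 - a)" "max (1 / 2) (1 - a) < 1" using a by auto
    fix x
    let ?p = "closest_point common x"
    obtain j where j: "j \<in> {1..M}" "c * (norm (x - ?p))\<^sup>2 \<le> (norm (update x j))\<^sup>2"
      using c(2) by blast
    have "measure_pmf.expectation (fedrk_round C M N T x) (\<lambda>y. (norm (y - ?p))\<^sup>2)
        \<le> (norm (x - ?p))\<^sup>2 - (norm (update x j))\<^sup>2 / (card selections * N)"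
      by (intro expectation_fedrk_round_decrease T j
          closest_point_subspace_in subspace_common)
    also have "\<dots> \<le> (norm (x - ?p))\<^sup>2 - c * (norm (x - ?p))\<^sup>2 / (card selections * N)"
      using K j(2) by (intro diff_left_mono divide_right_mono) auto
    also have "\<dots> = (1 - a) * (norm (x - ?p))\<^sup>2"
      by (simp add: a_def algebra_simps)
    also have "\<dots> \<le> max (1 / 2) (1 - a) * (norm (x - ?p))\<^sup>2"
      by (intro mult_right_mono) auto
    finally show "measure_pmf.expectation (fedrk_round C M N T x) (\<lambda>y. (norm (y - ?p))\<^sup>2)
        \<le> max (1 / 2) (1 - a) * (norm (x - ?p))\<^sup>2" .
  qed
qed

text \<open>
  The contraction of a round is towards the projection of the current model. It can be iterated
  because that projection is the same point in all rounds.
\<close>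

lemma fedrk_projection:
  "y \<in> set_pmf (fedrk C M N T x0 t) \<Longrightarrow> closest_point common y = closest_point common x0"
  by (induction t arbitrary: y) (auto dest: fedrk_round_projection)

lemma fedrk_linear_convergence:
  assumes T: "1 \<le> T"
  obtains \<beta> where "0 < \<beta>" "\<beta> < 1"
    "\<And>x0 t. measure_pmf.expectation (fedrk C M N T x0 t)
            (\<lambda>y. (norm (y - closest_point common x0))\<^sup>2)
          \<le> \<beta> ^ t * (norm (x0 - closest_point common x0))\<^sup>2"
proof -
  from fedrk_round_contraction[OF T] obtain \<beta> where \<beta>: "0 < \<beta>" "\<beta> < 1"
    "\<And>x. measure_pmf.expectation (fedrk_round C M N T x)
            (\<lambda>y. (norm (y - closest_point common x))\<^sup>2)
          \<le> \<beta> * (norm (x - closest_point common x))\<^sup>2" by blast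
  show thesis
  proof (rule that[OF \<beta>(1,2)])
    fix x0 t
    let ?p = "closest_point common x0"
    let ?V = "\<lambda>y. (norm (y - ?p))\<^sup>2"
    show "measure_pmf.expectation (fedrk C M N T x0 t) ?V \<le> \<beta> ^ t * ?V x0"
    proof (induction t)
      case (Suc t)
      have fin: "finite (set_pmf (fedrk C M N T x0 t))"
        by (rule finite_set_pmf_fedrk[OF N(2)])
      have "measure_pmf.expectation (fedrk C M N T x0 (Suc t)) ?V
          = measure_pmf.expectation (fedrk C M N T x0 t)
              (\<lambda>x. measure_pmf.expectation (fedrk_round C M N T x) ?V)"
        unfolding fedrk.simps
        by (intro expectation_bind_finite fin finite_set_pmf_fedrk_round)
      also have "\<dots> \<le> measure_pmf.expectation (fedrk C M N T x0 t) (\<lambda>x. \<beta> * ?V x)"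
      proof (rule expectation_mono_finite[OF fin])
        fix x assume "x \<in> set_pmf (fedrk C M N T x0 t)"
        then have "closest_point common x = ?p" by (rule fedrk_projection)
        with \<beta>(3)[of x]
        show "measure_pmf.expectation (fedrk_round C M N T x) ?V \<le> \<beta> * ?V x" by simp
      qed
      also have "\<dots> = \<beta> * measure_pmf.expectation (fedrk C M N T x0 t) ?V" by simp
      also have "\<dots> \<le> \<beta> * (\<beta> ^ t * ?V x0)"
        using Suc \<beta>(1) by (intro mult_left_mono) auto
      finally show ?case by (simp add: mult.assoc)
    qed simp
  qed
qed

end

section \<open>Linear systems\<close>

lemma subspace_client_sols:
  assumes "A *v 0 = b"
  shows "subspace (client_sols A b blk i)"
proof -
  have "b = 0" using assms by simp
  then show ?thesis
    by (auto simp: client_sols_def subspace_def matrix_vector_right_distrib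
        matrix_vector_mult_scaleR)
qed

theorem corollary1:
  fixes A :: "real^'n^'m" and b :: "real^'m"
    and M N T :: nat and blk :: "'m \<Rightarrow> nat"
    and X0 :: "real^'n"
  assumes "blk ` UNIV \<subseteq> {1..M}"
    and "A *v 0 = b"
    and "1 \<le> T"
    and "1 \<le> N" and "N \<le> M"
  shows "\<exists>\<beta>::real. 0 < \<beta> \<and> \<beta> < 1 \<and>
    (\<forall>t::nat.
      measure_pmf.expectation (fedrk (client_sols A b blk) M N T X0 (Suc t))
        (\<lambda>x. (norm (x - closest_point (\<Inter>i\<in>{1..M}. client_sols A b blk i) X0))\<^sup>2)
      \<le> \<beta> ^ (t + 1) * (norm X0)\<^sup>2)"
proof -
  let ?C = "client_sols A b blk"
  let ?D = "\<Inter>i\<in>{1..M}. ?C i"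
  have sub: "subspace (?C i)" for i
    by (rule subspace_client_sols[OF assms(2)])
  then have D: "subspace ?D"
    by (auto intro: subspace_Inter)
  have "dist X0 (closest_point ?D X0) \<le> dist X0 0"
    by (intro closest_point_le closed_subspace subspace_0 D)
  then have X0: "(norm (X0 - closest_point ?D X0))\<^sup>2 \<le> (norm X0)\<^sup>2"
    by (simp add: dist_norm)
  obtain \<beta> where \<beta>: "0 < \<beta>" "\<beta> < 1"
    "\<And>x0 t. measure_pmf.expectation (fedrk ?C M N T x0 t)
            (\<lambda>y. (norm (y - closest_point ?D x0))\<^sup>2)
          \<le> \<beta> ^ t * (norm (x0 - closest_point ?D x0))\<^sup>2"
    using fedrk_linear_convergence[of M ?C N T] sub assms(3-5) by blast
  have "measure_pmf.expectation (fedrk ?C M N T X0 (Suc t))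
          (\<lambda>y. (norm (y - closest_point ?D X0))\<^sup>2)
        \<le> \<beta> ^ (t + 1) * (norm X0)\<^sup>2" for t
  proof -
    have "\<beta> ^ Suc t * (norm (X0 - closest_point ?D X0))\<^sup>2 \<le> \<beta> ^ Suc t * (norm X0)\<^sup>2"
      using \<beta>(1) X0 by (intro mult_left_mono) auto
    with \<beta>(3)[of X0 "Suc t"] show ?thesis by simp
  qed
  with \<beta>(1,2) show ?thesis by blast
qed

end
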